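(* Let $k$ be a field, let $X$ be a set with $|X|>1$, and let $k\langle X\rangle$ be the free associative unital $k$-algebra generated by $X$. Then every countably generated left $k\langle X\rangle$-module can be embedded into a cyclic left $k\langle X\rangle$-module; that is, for every left $k\langle X\rangle$-module $M$ generated by an at most countable set there exist a left $k\langle X\rangle$-module $M'$ generated by a single element and an injective $k\langle X\rangle$-module homomorphism $M\to M'$.
   Context: Modules are unital left modules. *)

theory Defs
  imports "HOL-Algebra.Module" "HOL-Library.Countable_Set"
begin

section \<open>Unital left modules over a not necessarily commutative ring\<close>

text \<open>
  The library locale \<^locale>\<open>module\<close> requires a commutative ring.  The following is the same
  list of axioms over a \<^locale>\<open>ring\<close>.  The library locale \<^locale>\<open>submodule\<close> does not mention
  commutativity and is reused as it is.
\<close>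

locale left_module = R?: ring R + M?: abelian_group M for R (structure) and M (structure) +
  assumes smult_closed [simp, intro]:
      "\<lbrakk>a \<in> carrier R; x \<in> carrier M\<rbrakk> \<Longrightarrow> a \<odot>\<^bsub>M\<^esub> x \<in> carrier M"
    and smult_l_distr:
      "\<lbrakk>a \<in> carrier R; b \<in> carrier R; x \<in> carrier M\<rbrakk> \<Longrightarrow>
       (a \<oplus> b) \<odot>\<^bsub>M\<^esub> x = a \<odot>\<^bsub>M\<^esub> x \<oplus>\<^bsub>M\<^esub> b \<odot>\<^bsub>M\<^esub> x"
    and smult_r_distr:
      "\<lbrakk>a \<in> carrier R; x \<in> carrier M; y \<in> carrier M\<rbrakk> \<Longrightarrow>
       a \<odot>\<^bsub>M\<^esub> (x \<oplus>\<^bsub>M\<^esub> y) = a \<odot>\<^bsub>M\<^esub> x \<oplus>\<^bsub>M\<^esub> a \<odot>\<^bsub>M\<^esub> y"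
    and smult_assoc:
      "\<lbrakk>a \<in> carrier R; b \<in> carrier R; x \<in> carrier M\<rbrakk> \<Longrightarrow>
       (a \<otimes> b) \<odot>\<^bsub>M\<^esub> x = a \<odot>\<^bsub>M\<^esub> (b \<odot>\<^bsub>M\<^esub> x)"
    and smult_one [simp]:
      "x \<in> carrier M \<Longrightarrow> \<one> \<odot>\<^bsub>M\<^esub> x = x"

definition generated_submodule ::
    "('a, 'r) ring_scheme \<Rightarrow> ('a, 'b, 'm) module_scheme \<Rightarrow> 'b set \<Rightarrow> 'b set"
  where "generated_submodule R M S = \<Inter>{N. submodule N R M \<and> S \<subseteq> N}"

definition generates_module ::
    "('a, 'r) ring_scheme \<Rightarrow> ('a, 'b, 'm) module_scheme \<Rightarrow> 'b set \<Rightarrow> bool"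
  where "generates_module R M S \<longleftrightarrow> S \<subseteq> carrier M \<and> generated_submodule R M S = carrier M"

definition countably_generated_module ::
    "('a, 'r) ring_scheme \<Rightarrow> ('a, 'b, 'm) module_scheme \<Rightarrow> bool"
  where "countably_generated_module R M \<longleftrightarrow> (\<exists>S. countable S \<and> generates_module R M S)"

definition cyclic_module ::
    "('a, 'r) ring_scheme \<Rightarrow> ('a, 'b, 'm) module_scheme \<Rightarrow> bool"
  where "cyclic_module R M \<longleftrightarrow> (\<exists>x. generates_module R M {x})"

definition left_module_hom ::
    "('a, 'r) ring_scheme \<Rightarrow> ('a, 'b, 'm) module_scheme \<Rightarrow> ('a, 'c, 'n) module_scheme
      \<Rightarrow> ('b \<Rightarrow> 'c) set"
  where "left_module_hom R M N =
    {h \<in> hom (add_monoid M) (add_monoid N).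
       \<forall>a \<in> carrier R. \<forall>x \<in> carrier M. h (a \<odot>\<^bsub>M\<^esub> x) = a \<odot>\<^bsub>N\<^esub> h x}"


section \<open>The free associative unital algebra on a set\<close>

text \<open>
  An element of \<open>K\<langle>X\<rangle>\<close> is the coefficient function of a finite linear combination of words
  over \<open>X\<close>.  Words are lists; a coefficient function vanishes at every list that is not a word
  over \<open>X\<close>, so that it is determined by its values on words.  The product is convolution with
  respect to concatenation: the pairs \<open>(u, v)\<close> with \<open>u @ v = w\<close> are exactly the pairs
  \<open>(take i w, drop i w)\<close> for \<open>i \<le> length w\<close>, without repetition.
\<close>

definition free_algebra_carrier :: "('k, 'p) ring_scheme \<Rightarrow> 'x set \<Rightarrow> ('x list \<Rightarrow> 'k) set"
  where "free_algebra_carrier K X =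
    {f. range f \<subseteq> carrier K \<and> finite {w. f w \<noteq> \<zero>\<^bsub>K\<^esub>} \<and> {w. f w \<noteq> \<zero>\<^bsub>K\<^esub>} \<subseteq> lists X}"

definition free_algebra :: "('k, 'p) ring_scheme \<Rightarrow> 'x set \<Rightarrow> ('k, 'x list \<Rightarrow> 'k) module"
  where "free_algebra K X =
    \<lparr>carrier = free_algebra_carrier K X,
     mult = (\<lambda>f g w. \<Oplus>\<^bsub>K\<^esub>i \<in> {..length w}. f (take i w) \<otimes>\<^bsub>K\<^esub> g (drop i w)),
     one = (\<lambda>w. if w = [] then \<one>\<^bsub>K\<^esub> else \<zero>\<^bsub>K\<^esub>),
     zero = (\<lambda>w. \<zero>\<^bsub>K\<^esub>),
     add = (\<lambda>f g w. f w \<oplus>\<^bsub>K\<^esub> g w),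
     smult = (\<lambda>c f w. c \<otimes>\<^bsub>K\<^esub> f w)\<rparr>"

context ring
begin

lemma free_algebra_carrierD:
  assumes "f \<in> free_algebra_carrier R X"
  shows "f w \<in> carrier R" "finite {w. f w \<noteq> \<zero>}" "f w \<noteq> \<zero> \<Longrightarrow> w \<in> lists X"
  using assms by (auto simp: free_algebra_carrier_def)

lemma free_algebra_carrierI:
  assumes "\<And>w. f w \<in> carrier R" "finite A" "\<And>w. f w \<noteq> \<zero> \<Longrightarrow> w \<in> A \<inter> lists X"
  shows "f \<in> free_algebra_carrier R X"
proof -
  have "{w. f w \<noteq> \<zero>} \<subseteq> A" using assms(3) by auto
  then have "finite {w. f w \<noteq> \<zero>}" using assms(2) finite_subset by blast
  then show ?thesis using assms(1,3) by (auto simp: free_algebra_carrier_def)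
qed

lemma free_algebra_add_closed:
  assumes f: "f \<in> free_algebra_carrier R X" and g: "g \<in> free_algebra_carrier R X"
  shows "(\<lambda>w. f w \<oplus> g w) \<in> free_algebra_carrier R X"
proof (rule free_algebra_carrierI)
  show "finite ({w. f w \<noteq> \<zero>} \<union> {w. g w \<noteq> \<zero>})"
    using free_algebra_carrierD(2)[OF f] free_algebra_carrierD(2)[OF g] by simp
  show "f w \<oplus> g w \<in> carrier R" for w
    using free_algebra_carrierD(1)[OF f] free_algebra_carrierD(1)[OF g] by simp
  fix w assume "f w \<oplus> g w \<noteq> \<zero>"
  then have "f w \<noteq> \<zero> \<or> g w \<noteq> \<zero>" by auto
  then show "w \<in> ({w. f w \<noteq> \<zero>} \<union> {w. g w \<noteq> \<zero>}) \<inter> lists X"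
    using free_algebra_carrierD(3)[OF f] free_algebra_carrierD(3)[OF g] by auto
qed

lemma free_algebra_smult_closed:
  assumes c: "c \<in> carrier R" and f: "f \<in> free_algebra_carrier R X"
  shows "(\<lambda>w. c \<otimes> f w) \<in> free_algebra_carrier R X"
proof (rule free_algebra_carrierI)
  show "finite {w. f w \<noteq> \<zero>}" by (rule free_algebra_carrierD(2)[OF f])
  show "c \<otimes> f w \<in> carrier R" for w using c free_algebra_carrierD(1)[OF f] by simp
  fix w assume "c \<otimes> f w \<noteq> \<zero>"
  then have "f w \<noteq> \<zero>" using c by auto
  then show "w \<in> {w. f w \<noteq> \<zero>} \<inter> lists X" using free_algebra_carrierD(3)[OF f] by auto
qed

lemma free_algebra_mult_closed:
  assumes f: "f \<in> free_algebra_carrier R X" and g: "g \<in> free_algebra_carrier R X"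
  shows "(\<lambda>w. \<Oplus>i\<in>{..length w}. f (take i w) \<otimes> g (drop i w)) \<in> free_algebra_carrier R X"
proof (rule free_algebra_carrierI)
  note fc = free_algebra_carrierD(1)[OF f] and gc = free_algebra_carrierD(1)[OF g]
  let ?A = "(\<lambda>(u, v). u @ v) ` ({w. f w \<noteq> \<zero>} \<times> {w. g w \<noteq> \<zero>})"
  show "finite ?A"
    using free_algebra_carrierD(2)[OF f] free_algebra_carrierD(2)[OF g] by simp
  show "(\<Oplus>i\<in>{..length w}. f (take i w) \<otimes> g (drop i w)) \<in> carrier R" for w
    by (rule finsum_closed) (simp add: Pi_def fc gc)
  fix w assume nz: "(\<Oplus>i\<in>{..length w}. f (take i w) \<otimes> g (drop i w)) \<noteq> \<zero>"
  have "\<exists>i. f (take i w) \<otimes> g (drop i w) \<noteq> \<zero>"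
  proof (rule ccontr)
    assume "\<not> ?thesis"
    then show False using nz by simp
  qed
  then obtain i where i: "f (take i w) \<otimes> g (drop i w) \<noteq> \<zero>" ..
  have fi: "f (take i w) \<noteq> \<zero>" using i gc by auto
  have gi: "g (drop i w) \<noteq> \<zero>" using i fc by auto
  have "(take i w, drop i w) \<in> {w. f w \<noteq> \<zero>} \<times> {w. g w \<noteq> \<zero>}" using fi gi by simp
  then have "(\<lambda>(u, v). u @ v) (take i w, drop i w) \<in> ?A" by (rule imageI)
  then have "w \<in> ?A" by simp
  moreover have "take i w @ drop i w \<in> lists X"
    using free_algebra_carrierD(3)[OF f fi] free_algebra_carrierD(3)[OF g gi]
    by (simp only: append_in_lists_conv)
  ultimately show "w \<in> ?A \<inter> lists X" by simp
qed

lemma finsum_triangle_reindex: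
  assumes "\<And>i j. t i j \<in> carrier R"
  shows "(\<Oplus>i\<in>{..n::nat}. \<Oplus>j\<in>{..i}. t j i) = (\<Oplus>j\<in>{..n}. \<Oplus>i\<in>{..n - j}. t j (i + j))"
proof (induction n)
  case 0
  show ?case using assms by (simp add: Pi_def)
next
  case (Suc n)
  have "(\<Oplus>j\<in>{..n}. \<Oplus>i\<in>{..Suc n - j}. t j (i + j))
      = (\<Oplus>j\<in>{..n}. t j (Suc n) \<oplus> (\<Oplus>i\<in>{..n - j}. t j (i + j)))"
    by (rule finsum_cong) (auto simp: Suc_diff_le assms Pi_def simp_implies_def)
  also have "\<dots> = (\<Oplus>j\<in>{..n}. t j (Suc n)) \<oplus> (\<Oplus>j\<in>{..n}. \<Oplus>i\<in>{..n - j}. t j (i + j))"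
    by (rule finsum_addf) (auto simp: assms Pi_def)
  finally show ?case
    using Suc assms by (simp add: Pi_def a_assoc)
qed

lemma free_algebra_mult_assoc:
  assumes f: "\<And>w. f w \<in> carrier R" and g: "\<And>w. g w \<in> carrier R" and h: "\<And>w. h w \<in> carrier R"
  shows "(\<Oplus>i\<in>{..length w}.
            (\<Oplus>j\<in>{..length (take i w)}. f (take j (take i w)) \<otimes> g (drop j (take i w))) \<otimes> h (drop i w))
       = (\<Oplus>j\<in>{..length w}.
            f (take j w) \<otimes> (\<Oplus>i\<in>{..length (drop j w)}. g (take i (drop j w)) \<otimes> h (drop i (drop j w))))"
    (is "?L = ?R")
proof -
  define t where
    "t j i = f (take j w) \<otimes> (g (take (i - j) (drop j w)) \<otimes> h (drop i w))" for j i
  have t: "t j i \<in> carrier R" for j i by (simp add: t_def f g h)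
  have "?L = (\<Oplus>i\<in>{..length w}. \<Oplus>j\<in>{..i}. t j i)"
  proof (rule finsum_cong', simp, simp add: t Pi_def)
    fix i assume i: "i \<in> {..length w}"
    then have len: "length (take i w) = i" by simp
    have "(\<Oplus>j\<in>{..i}. f (take j (take i w)) \<otimes> g (drop j (take i w))) \<otimes> h (drop i w)
        = (\<Oplus>j\<in>{..i}. f (take j (take i w)) \<otimes> g (drop j (take i w)) \<otimes> h (drop i w))"
      by (rule finsum_ldistr) (auto simp: f g h Pi_def)
    also have "\<dots> = (\<Oplus>j\<in>{..i}. t j i)"
      by (rule finsum_cong)
        (auto simp: t f g h Pi_def simp_implies_def t_def m_assoc min_def drop_take)
    finally show "(\<Oplus>j\<in>{..length (take i w)}. f (take j (take i w)) \<otimes> g (drop j (take i w))) \<otimes> h (drop i w)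
        = (\<Oplus>j\<in>{..i}. t j i)"
      by (simp only: len)
  qed
  also have "\<dots> = (\<Oplus>j\<in>{..length w}. \<Oplus>i\<in>{..length w - j}. t j (i + j))"
    by (rule finsum_triangle_reindex) (rule t)
  also have "\<dots> = ?R"
  proof (rule finsum_cong', simp, simp add: f g h Pi_def)
    fix j assume "j \<in> {..length w}"
    show "(\<Oplus>i\<in>{..length w - j}. t j (i + j)) =
      f (take j w) \<otimes> (\<Oplus>i\<in>{..length (drop j w)}. g (take i (drop j w)) \<otimes> h (drop i (drop j w)))"
      by (subst finsum_rdistr) (auto simp: f g h t_def Pi_def)
  qed
  finally show ?thesis .
qed

lemma free_algebra_l_one:
  assumes f: "\<And>w. f w \<in> carrier R"
  shows "(\<Oplus>i\<in>{..length w}. (if take i w = [] then \<one> else \<zero>) \<otimes> f (drop i w)) = f w"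
proof -
  have "(\<Oplus>i\<in>{..length w}. (if take i w = [] then \<one> else \<zero>) \<otimes> f (drop i w))
      = (\<Oplus>i\<in>{..length w}. if 0 = i then f (drop i w) else \<zero>)"
    by (rule finsum_cong) (auto simp: f Pi_def simp_implies_def)
  also have "\<dots> = f (drop 0 w)"
    by (rule finsum_singleton) (auto simp: f Pi_def)
  finally show ?thesis by simp
qed

lemma free_algebra_r_one:
  assumes f: "\<And>w. f w \<in> carrier R"
  shows "(\<Oplus>i\<in>{..length w}. f (take i w) \<otimes> (if drop i w = [] then \<one> else \<zero>)) = f w"
proof -
  have "(\<Oplus>i\<in>{..length w}. f (take i w) \<otimes> (if drop i w = [] then \<one> else \<zero>))
      = (\<Oplus>i\<in>{..length w}. if length w = i then f (take i w) else \<zero>)"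
    by (rule finsum_cong) (auto simp: f Pi_def simp_implies_def)
  also have "\<dots> = f (take (length w) w)"
    by (rule finsum_singleton) (auto simp: f Pi_def)
  finally show ?thesis by simp
qed

lemma free_algebra_abelian_group: "abelian_group (free_algebra R X)"
proof (rule abelian_groupI)
  show "\<zero>\<^bsub>free_algebra R X\<^esub> \<in> carrier (free_algebra R X)"
    by (simp add: free_algebra_def free_algebra_carrier_def)
next
  fix f assume f: "f \<in> carrier (free_algebra R X)"
  then have f': "f \<in> free_algebra_carrier R X" by (simp add: free_algebra_def)
  note fc = free_algebra_carrierD(1)[OF f']
  show "\<exists>g\<in>carrier (free_algebra R X). g \<oplus>\<^bsub>free_algebra R X\<^esub> f = \<zero>\<^bsub>free_algebra R X\<^esub>"
  proof
    show "(\<lambda>w. \<ominus> \<one> \<otimes> f w) \<in> carrier (free_algebra R X)"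
      using free_algebra_smult_closed[OF _ f'] by (simp add: free_algebra_def)
    show "(\<lambda>w. \<ominus> \<one> \<otimes> f w) \<oplus>\<^bsub>free_algebra R X\<^esub> f = \<zero>\<^bsub>free_algebra R X\<^esub>"
      by (simp add: free_algebra_def fun_eq_iff l_minus l_neg fc)
  qed
qed (auto simp: free_algebra_def free_algebra_add_closed free_algebra_carrierD(1) a_ac)

lemma free_algebra_ring: "ring (free_algebra R X)"
proof (rule ringI)
  show "abelian_group (free_algebra R X)" by (rule free_algebra_abelian_group)
  show "monoid (free_algebra R X)"
  proof (rule monoidI)
    show "\<one>\<^bsub>free_algebra R X\<^esub> \<in> carrier (free_algebra R X)"
    proof -
      have "(\<lambda>w. if w = [] then \<one> else \<zero>) \<in> free_algebra_carrier R X"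
        by (rule free_algebra_carrierI[of _ "{[]}"]) (simp_all split: if_splits)
      then show ?thesis by (simp add: free_algebra_def)
    qed
  next
    fix f g h
    assume fgh: "f \<in> carrier (free_algebra R X)" "g \<in> carrier (free_algebra R X)"
      "h \<in> carrier (free_algebra R X)"
    then have c: "f w \<in> carrier R" "g w \<in> carrier R" "h w \<in> carrier R" for w
      by (auto simp: free_algebra_def dest: free_algebra_carrierD(1))
    show "f \<otimes>\<^bsub>free_algebra R X\<^esub> g \<in> carrier (free_algebra R X)"
      using fgh by (simp add: free_algebra_def free_algebra_mult_closed)
    show "\<one>\<^bsub>free_algebra R X\<^esub> \<otimes>\<^bsub>free_algebra R X\<^esub> f = f"
      using free_algebra_l_one[of f, OF c(1)] by (simp only: free_algebra_def ring.simps monoid.simps)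
    show "f \<otimes>\<^bsub>free_algebra R X\<^esub> \<one>\<^bsub>free_algebra R X\<^esub> = f"
      using free_algebra_r_one[of f, OF c(1)] by (simp only: free_algebra_def ring.simps monoid.simps)
    show "(f \<otimes>\<^bsub>free_algebra R X\<^esub> g) \<otimes>\<^bsub>free_algebra R X\<^esub> h
        = f \<otimes>\<^bsub>free_algebra R X\<^esub> (g \<otimes>\<^bsub>free_algebra R X\<^esub> h)"
      using free_algebra_mult_assoc[of f g h, OF c]
      by (simp only: free_algebra_def ring.simps monoid.simps)
  qed
next
  fix f g h
  assume "f \<in> carrier (free_algebra R X)" "g \<in> carrier (free_algebra R X)"
    "h \<in> carrier (free_algebra R X)"
  then have c: "f w \<in> carrier R" "g w \<in> carrier R" "h w \<in> carrier R" for w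
    by (auto simp: free_algebra_def dest: free_algebra_carrierD(1))
  show "(f \<oplus>\<^bsub>free_algebra R X\<^esub> g) \<otimes>\<^bsub>free_algebra R X\<^esub> h
      = f \<otimes>\<^bsub>free_algebra R X\<^esub> h \<oplus>\<^bsub>free_algebra R X\<^esub> g \<otimes>\<^bsub>free_algebra R X\<^esub> h"
    by (simp add: free_algebra_def fun_eq_iff c l_distr Pi_def)
  show "h \<otimes>\<^bsub>free_algebra R X\<^esub> (f \<oplus>\<^bsub>free_algebra R X\<^esub> g)
      = h \<otimes>\<^bsub>free_algebra R X\<^esub> f \<oplus>\<^bsub>free_algebra R X\<^esub> h \<otimes>\<^bsub>free_algebra R X\<^esub> g"
    by (simp add: free_algebra_def fun_eq_iff c r_distr Pi_def)
qed

end

lemma (in cring) free_algebra_module: "module R (free_algebra R X)"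
proof (rule moduleI)
  show "cring R" by (rule is_cring)
  show "abelian_group (free_algebra R X)" by (rule free_algebra_abelian_group)
qed (auto simp: free_algebra_def free_algebra_smult_closed free_algebra_carrierD(1)
    l_distr r_distr m_assoc)

end

theory Submission
  imports Defs "HOL-Algebra.Ideal"
begin

text \<open>
  Let \<open>x \<noteq> y\<close> be letters and let \<open>m\<^sub>0, m\<^sub>1, \<dots>\<close> generate \<open>M\<close>.  Write \<open>f = \<Sum>\<^sub>i f\<^sub>i x y\<^sup>i + r\<close>, where
  no word of \<open>r\<close> has a suffix \<open>x y\<^sup>i\<close>; the \<open>f\<^sub>i\<close> are unique because none of these suffixes is a
  suffix of another one.  On the left ideal \<open>L\<close> of all \<open>f\<close> in which no power of \<open>y\<close> occurs,
  \<open>(a f)\<^sub>i = a f\<^sub>i\<close>, so \<open>f \<mapsto> \<Sum>\<^sub>i f\<^sub>i m\<^sub>i\<close> is a homomorphism from \<open>L\<close> onto \<open>M\<close>.  Its kernel \<open>I\<close> is a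
  left ideal, and \<open>M \<cong> L / I\<close> is a submodule of the cyclic module \<open>K\<langle>X\<rangle> / I\<close>.
\<close>

section \<open>Left ideals and their quotient modules\<close>

locale left_ideal = additive_subgroup I R + ring R for I and R (structure) +
  assumes l_closed: "\<lbrakk>a \<in> carrier R; f \<in> I\<rbrakk> \<Longrightarrow> a \<otimes> f \<in> I"

sublocale left_ideal \<subseteq> abelian_subgroup I R
  by (rule abelian_subgroupI3) unfold_locales

text \<open>The fields \<open>mult\<close> and \<open>one\<close> have no meaning for a module.\<close>

definition left_quotient :: "('a, 'r) ring_scheme \<Rightarrow> 'a set \<Rightarrow> ('a, 'a set) module"
  where "left_quotient R I =
    \<lparr>carrier = a_rcosets\<^bsub>R\<^esub> I, mult = (\<lambda>_ _. I), one = I, zero = I, add = set_add R,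
     smult = (\<lambda>a C. \<Union>c\<in>C. I +>\<^bsub>R\<^esub> (a \<otimes>\<^bsub>R\<^esub> c))\<rparr>"

context left_ideal
begin

lemma carrier_left_quotient: "carrier (left_quotient R I) = (\<lambda>f. I +> f) ` carrier R"
  by (auto simp: left_quotient_def A_RCOSETS_def')

lemma add_left_quotient:
  "\<lbrakk>f \<in> carrier R; g \<in> carrier R\<rbrakk> \<Longrightarrow> (I +> f) \<oplus>\<^bsub>left_quotient R I\<^esub> (I +> g) = I +> (f \<oplus> g)"
  by (simp add: left_quotient_def a_rcos_sum)

lemma zero_left_quotient: "\<zero>\<^bsub>left_quotient R I\<^esub> = I +> \<zero>"
  using a_coset_add_zero[of I] a_subset by (simp add: left_quotient_def)

text \<open>All cosets in the union that defines the scalar multiplication coincide: changing the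
  representative \<open>f\<close> by \<open>u \<in> I\<close> changes \<open>a \<otimes> f\<close>
  by \<open>a \<otimes> u\<close>, which stays in \<open>I\<close>. The union therefore spares the
  choice of a representative.\<close>

lemma smult_left_quotient:
  assumes a: "a \<in> carrier R" and f: "f \<in> carrier R"
  shows "a \<odot>\<^bsub>left_quotient R I\<^esub> (I +> f) = I +> (a \<otimes> f)"
proof -
  have "I +> (a \<otimes> g) = I +> (a \<otimes> f)" if g: "g \<in> I +> f" for g
  proof -
    obtain u where u: "u \<in> I" "g = u \<oplus> f" using g by (auto simp: a_r_coset_def')
    then have "a \<otimes> g = a \<otimes> u \<oplus> a \<otimes> f" using a f by (simp add: r_distr)
    then have "a \<otimes> g \<in> I +> (a \<otimes> f)" using l_closed[OF a u(1)] by (auto simp: a_r_coset_def')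
    then show ?thesis using a_repr_independence' a f by auto
  qed
  \<comment> \<open>The coset is nonempty, so the union of equal cosets is not the empty
    set.\<close>
  moreover have "f \<in> I +> f" using f by (rule a_rcos_self)
  ultimately have "(\<Union>g\<in>I +> f. I +> (a \<otimes> g)) = I +> (a \<otimes> f)" by blast
  then show ?thesis by (simp add: left_quotient_def)
qed

lemmas left_quotient_simps =
  carrier_left_quotient add_left_quotient zero_left_quotient smult_left_quotient

lemma left_module_left_quotient: "left_module R (left_quotient R I)"
proof -
  have "abelian_group (left_quotient R I)"
  proof (rule abelian_groupI)
    fix C assume "C \<in> carrier (left_quotient R I)"
    then obtain f where f: "f \<in> carrier R" "C = I +> f" by (auto simp: left_quotient_simps)
    then have "(I +> \<ominus> f) \<oplus>\<^bsub>left_quotient R I\<^esub> C = \<zero>\<^bsub>left_quotient R I\<^esub>"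
      by (simp add: left_quotient_simps l_neg)
    then show "\<exists>D\<in>carrier (left_quotient R I). D \<oplus>\<^bsub>left_quotient R I\<^esub> C = \<zero>\<^bsub>left_quotient R I\<^esub>"
      using f by (auto simp: left_quotient_simps)
  qed (auto simp: left_quotient_simps a_ac)
  then show ?thesis
    by (intro left_module.intro left_module_axioms.intro ring_axioms)
      (auto simp: left_quotient_simps l_distr r_distr m_assoc)
qed

end

section \<open>Submodules, generation and embeddings into cyclic quotients\<close>

context left_module
begin

lemma smult_l_null: "u \<in> carrier M \<Longrightarrow> \<zero> \<odot>\<^bsub>M\<^esub> u = \<zero>\<^bsub>M\<^esub>"
  using smult_l_distr[of \<zero> \<zero> u]
  by (metis M.add.r_cancel_one' R.l_zero R.zero_closed smult_closed)

lemma smult_r_null: "a \<in> carrier R \<Longrightarrow> a \<odot>\<^bsub>M\<^esub> \<zero>\<^bsub>M\<^esub> = \<zero>\<^bsub>M\<^esub>"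
  using smult_r_distr[of a "\<zero>\<^bsub>M\<^esub>" "\<zero>\<^bsub>M\<^esub>"]
  by (metis M.add.r_cancel_one' M.l_zero M.zero_closed smult_closed)

lemma finsum_smult_distr:
  assumes "finite B" "a \<in> carrier R" "\<And>i. i \<in> B \<Longrightarrow> u i \<in> carrier M"
  shows "a \<odot>\<^bsub>M\<^esub> (\<Oplus>\<^bsub>M\<^esub>i\<in>B. u i) = (\<Oplus>\<^bsub>M\<^esub>i\<in>B. a \<odot>\<^bsub>M\<^esub> u i)"
  using assms by induction (simp_all add: smult_r_null smult_r_distr Pi_def)

lemma submodule_carrier: "submodule (carrier M) R M"
  by (intro submodule.intro submodule_axioms.intro M.add.subgroup_self) auto

lemma submoduleI:
  assumes "H \<subseteq> carrier M" "\<zero>\<^bsub>M\<^esub> \<in> H"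
    and add: "\<And>u v. \<lbrakk>u \<in> H; v \<in> H\<rbrakk> \<Longrightarrow> u \<oplus>\<^bsub>M\<^esub> v \<in> H"
    and smult: "\<And>a u. \<lbrakk>a \<in> carrier R; u \<in> H\<rbrakk> \<Longrightarrow> a \<odot>\<^bsub>M\<^esub> u \<in> H"
  shows "submodule H R M"
proof -
  \<comment> \<open>Closure under negatives follows from closure under scalars, as -u = (-1)
    u.\<close>
  have neg: "\<ominus>\<^bsub>M\<^esub> u \<in> H" if u: "u \<in> H" for u
  proof -
    have uM: "u \<in> carrier M" using u assms(1) by auto
    have "\<ominus> \<one> \<odot>\<^bsub>M\<^esub> u \<oplus>\<^bsub>M\<^esub> u = (\<ominus> \<one> \<oplus> \<one>) \<odot>\<^bsub>M\<^esub> u"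
      using uM by (simp only: smult_l_distr R.a_inv_closed R.one_closed smult_one)
    then have "\<ominus> \<one> \<odot>\<^bsub>M\<^esub> u = \<ominus>\<^bsub>M\<^esub> u" using uM by (simp add: smult_l_null M.minus_equality R.l_neg)
    then show ?thesis using smult[of "\<ominus> \<one>" u] u by simp
  qed
  show ?thesis
    by (intro submodule.intro submodule_axioms.intro M.add.subgroupI)
      (use assms neg in \<open>auto simp: a_inv_def[symmetric]\<close>)
qed

text \<open>The generated submodule is an intersection in which \<open>H\<close> is one of the
  members. This reduces surjectivity of a homomorphism to hitting the generators.\<close>

lemma submodule_eq_carrier:
  assumes "generates_module R M S" "submodule H R M" "S \<subseteq> H"
  shows "H = carrier M"
proof
  show "H \<subseteq> carrier M"
    using subgroup.subset[OF submodule.axioms(1)[OF assms(2)]] by simp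
  show "carrier M \<subseteq> H"
    using assms by (auto simp: generates_module_def generated_submodule_def)
qed

end

text \<open>The coset of \<open>\<one>\<close> is a generator, since the coset of \<open>f\<close>
  is \<open>f\<close> times the coset of \<open>\<one>\<close>.\<close>

lemma (in left_ideal) cyclic_left_quotient: "cyclic_module R (left_quotient R I)"
proof -
  interpret Q: left_module R "left_quotient R I" by (rule left_module_left_quotient)
  have "H = carrier (left_quotient R I)"
    if H: "submodule H R (left_quotient R I)" and one: "I +> \<one> \<in> H" for H
  proof
    show "H \<subseteq> carrier (left_quotient R I)"
      using subgroup.subset[OF submodule.axioms(1)[OF H]] by simp
    show "carrier (left_quotient R I) \<subseteq> H"
    proof
      fix C assume "C \<in> carrier (left_quotient R I)"
      then obtain f where f: "f \<in> carrier R" "C = I +> f" by (auto simp: left_quotient_simps)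
      then show "C \<in> H"
        using submodule.smult_closed[OF H f(1) one] by (simp add: left_quotient_simps)
    qed
  qed
  moreover have one: "I +> \<one> \<in> carrier (left_quotient R I)" by (simp add: left_quotient_simps)
  \<comment> \<open>The whole carrier must be seen to belong to this family: the intersection of an
    empty family would be the whole type.\<close>
  ultimately have "{H. submodule H R (left_quotient R I) \<and> {I +> \<one>} \<subseteq> H}
      = {carrier (left_quotient R I)}"
    using Q.submodule_carrier by blast
  then have "generates_module R (left_quotient R I) {I +> \<one>}"
    using one by (simp add: generates_module_def generated_submodule_def)
  then show ?thesis unfolding cyclic_module_def by blast
qed

text \<open>The fibres of \<open>p\<close> are cosets of its kernel, so \<open>m \<mapsto> p\<^sup>-\<^sup>1(m)\<close> is the embedding.\<close>

lemma (in left_module) subquotient_embeds_into_cyclic: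
  assumes "left_ideal L R"
    and add: "\<And>f g. \<lbrakk>f \<in> L; g \<in> L\<rbrakk> \<Longrightarrow> p (f \<oplus> g) = p f \<oplus>\<^bsub>M\<^esub> p g"
    and smult: "\<And>a f. \<lbrakk>a \<in> carrier R; f \<in> L\<rbrakk> \<Longrightarrow> p (a \<otimes> f) = a \<odot>\<^bsub>M\<^esub> p f"
    and onto: "p ` L = carrier M"
  shows "\<exists>(M' :: ('a, 'a set) module) h. left_module R M' \<and> cyclic_module R M' \<and>
           h \<in> left_module_hom R M M' \<and> inj_on h (carrier M)"
proof -
  interpret L: left_ideal L R by fact
  have pM: "p f \<in> carrier M" if "f \<in> L" for f using that onto by auto
  have p0: "p \<zero> = \<zero>\<^bsub>M\<^esub>"
    using add[of \<zero> \<zero>] pM[of \<zero>] by (metis L.zero_closed M.add.r_cancel_one' R.l_zero R.zero_closed)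
  have pinv: "p (\<ominus> f) = \<ominus>\<^bsub>M\<^esub> p f" if f: "f \<in> L" for f
    using add[of "\<ominus> f" f] f pM p0 by (simp add: R.l_neg M.minus_equality)
  define I where "I = {f \<in> L. p f = \<zero>\<^bsub>M\<^esub>}"
  interpret I: left_ideal I R
  proof (intro left_ideal.intro left_ideal_axioms.intro additive_subgroup.intro R.ring_axioms)
    show "subgroup I (add_monoid R)"
    proof (rule R.add.subgroupI)
      show "I \<subseteq> carrier R" using L.a_subset by (auto simp: I_def)
      show "I \<noteq> {}" using L.zero_closed p0 unfolding I_def by blast
    qed (auto simp: I_def add pinv a_inv_def[symmetric])
    show "a \<otimes> f \<in> I" if "a \<in> carrier R" "f \<in> I" for a f
      using that by (auto simp: I_def smult smult_r_null L.l_closed)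
  qed
  define h where "h m = {f \<in> L. p f = m}" for m
  \<comment> \<open>By \<open>onto\<close>, every element of \<open>M\<close> has the form
    \<open>p f\<close>, so this identity turns each claim about \<open>h\<close> into a computation
    with cosets.\<close>
  have h: "h (p f) = I +> f" if f: "f \<in> L" for f
  proof
    have fR: "f \<in> carrier R" using f by simp
    show "h (p f) \<subseteq> I +> f"
    proof
      fix g assume "g \<in> h (p f)"
      then have g: "g \<in> L" "p g = p f" by (auto simp: h_def)
      then have "g \<oplus> \<ominus> f \<in> I" using f pM by (simp add: I_def add pinv M.r_neg)
      moreover have "g = (g \<oplus> \<ominus> f) \<oplus> f" using g f by (simp add: R.a_assoc R.l_neg)
      ultimately show "g \<in> I +> f" by (auto simp: a_r_coset_def')
    qed
    show "I +> f \<subseteq> h (p f)"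
    proof
      fix g assume "g \<in> I +> f"
      then obtain u where u: "u \<in> L" "p u = \<zero>\<^bsub>M\<^esub>" "g = u \<oplus> f" unfolding a_r_coset_def' I_def by blast
      then have "p g = p f" using f pM[OF f] by (simp add: add)
      then show "g \<in> h (p f)" using u f by (simp add: h_def)
    qed
  qed
  have "h \<in> left_module_hom R M (left_quotient R I)"
  proof -
    have "h u \<in> carrier (left_quotient R I)" if "u \<in> carrier M" for u
    proof -
      obtain f where "f \<in> L" "u = p f" using \<open>u \<in> carrier M\<close> onto by blast
      then show ?thesis by (simp add: h I.left_quotient_simps)
    qed
    moreover have "h (u \<oplus>\<^bsub>M\<^esub> v) = h u \<oplus>\<^bsub>left_quotient R I\<^esub> h v"
      if uv: "u \<in> carrier M" "v \<in> carrier M" for u v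
    proof -
      obtain f g where "f \<in> L" "u = p f" "g \<in> L" "v = p g" using uv onto by blast
      then show ?thesis by (simp add: add[symmetric] h I.left_quotient_simps)
    qed
    moreover have "h (a \<odot>\<^bsub>M\<^esub> u) = a \<odot>\<^bsub>left_quotient R I\<^esub> h u"
      if au: "a \<in> carrier R" "u \<in> carrier M" for a u
    proof -
      obtain f where "f \<in> L" "u = p f" using au onto by blast
      then show ?thesis using au by (simp add: smult[symmetric] h L.l_closed I.left_quotient_simps)
    qed
    ultimately show ?thesis by (auto simp: left_module_hom_def hom_def)
  qed
  \<comment> \<open>Fibres over distinct elements are disjoint, and by \<open>onto\<close> the fibre
    over \<open>u\<close> is nonempty.\<close>
  moreover have "inj_on h (carrier M)"
  proof (rule inj_onI)
    fix u v assume u: "u \<in> carrier M" and eq: "h u = h v"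
    obtain f where "f \<in> L" "u = p f" using u onto by blast
    then have "f \<in> h v" using eq by (auto simp: h_def)
    then show "u = v" using \<open>u = p f\<close> by (simp add: h_def)
  qed
  ultimately show ?thesis
    using I.left_module_left_quotient I.cyclic_left_quotient by blast
qed

section \<open>Coefficients at the suffixes x y^i in the free algebra\<close>

definition strip_suffix :: "'x list \<Rightarrow> ('x list \<Rightarrow> 'k) \<Rightarrow> 'x list \<Rightarrow> 'k"
  where "strip_suffix s f = (\<lambda>v. f (v @ s))"

text \<open>Left multiplication by x takes y^i to x y^i, whose coefficient at the suffix x y^i is 1,
  while that of y^i is 0. Stripping thus fails to be linear on powers of \<open>y\<close>. The case
  \<open>j = 0\<close> removes the constant term for the same reason.\<close>

definition no_powers_ideal :: "('k, 'p) ring_scheme \<Rightarrow> 'x set \<Rightarrow> 'x \<Rightarrow> ('x list \<Rightarrow> 'k) set"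
  where "no_powers_ideal K X y = {f \<in> free_algebra_carrier K X. \<forall>j. f (replicate j y) = \<zero>\<^bsub>K\<^esub>}"

definition word_poly :: "('k, 'p) ring_scheme \<Rightarrow> 'x list \<Rightarrow> 'x list \<Rightarrow> 'k"
  where "word_poly K w = (\<lambda>v. if v = w then \<one>\<^bsub>K\<^esub> else \<zero>\<^bsub>K\<^esub>)"

lemma free_algebra_sel:
  "carrier (free_algebra K X) = free_algebra_carrier K X"
  "f \<oplus>\<^bsub>free_algebra K X\<^esub> g = (\<lambda>w. f w \<oplus>\<^bsub>K\<^esub> g w)"
  "f \<otimes>\<^bsub>free_algebra K X\<^esub> g = (\<lambda>w. \<Oplus>\<^bsub>K\<^esub>i \<in> {..length w}. f (take i w) \<otimes>\<^bsub>K\<^esub> g (drop i w))"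
  "\<zero>\<^bsub>free_algebra K X\<^esub> = (\<lambda>w. \<zero>\<^bsub>K\<^esub>)"
  "\<one>\<^bsub>free_algebra K X\<^esub> = word_poly K []"
  by (simp_all add: free_algebra_def word_poly_def)

context ring
begin

lemma strip_suffix_closed:
  assumes f: "f \<in> free_algebra_carrier R X"
  shows "strip_suffix s f \<in> free_algebra_carrier R X"
proof (rule free_algebra_carrierI)
  show "finite ((\<lambda>v. v @ s) -` {w. f w \<noteq> \<zero>})"
    by (rule finite_vimageI[OF free_algebra_carrierD(2)[OF f]]) (simp add: inj_def)
  show "strip_suffix s f w \<in> carrier R" for w
    using free_algebra_carrierD(1)[OF f] by (simp add: strip_suffix_def)
  show "w \<in> ((\<lambda>v. v @ s) -` {w. f w \<noteq> \<zero>}) \<inter> lists X" if "strip_suffix s f w \<noteq> \<zero>" for w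
    using that free_algebra_carrierD(3)[OF f, of "w @ s"] by (simp add: strip_suffix_def)
qed

text \<open>In the convolution at \<open>v @ x # replicate i y\<close>, the cuts up to the end of
  \<open>v\<close> form the product on the right-hand side. Every later cut leaves a power of
  \<open>y\<close> as the right factor, and there \<open>f\<close> vanishes.\<close>

lemma strip_suffix_mult:
  assumes a: "a \<in> free_algebra_carrier R X" and f: "f \<in> no_powers_ideal R X y"
  shows "strip_suffix (x # replicate i y) (a \<otimes>\<^bsub>free_algebra R X\<^esub> f)
       = a \<otimes>\<^bsub>free_algebra R X\<^esub> strip_suffix (x # replicate i y) f"
proof
  fix v
  let ?s = "x # replicate i y"
  have fX: "f \<in> free_algebra_carrier R X" and f0: "f (replicate j y) = \<zero>" for j
    using f by (auto simp: no_powers_ideal_def)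
  note ac = free_algebra_carrierD(1)[OF a] and fc = free_algebra_carrierD(1)[OF fX]
  have "f (drop j (v @ ?s)) = \<zero>" if j: "length v < j" for j
  proof -
    \<comment> \<open>The \<open>Suc\<close> accounts for the letter \<open>x\<close>, and
      \<open>k\<close> counts the letters \<open>y\<close> cut off with it. The last cut leaves the
      empty word, which is the power with exponent 0.\<close>
    obtain k where "j - length v = Suc k" using j by (metis Suc_diff_Suc)
    then have "drop j (v @ ?s) = replicate (i - k) y" using j by simp
    then show ?thesis using f0 by metis
  qed
  then have "(\<Oplus>j\<in>{..length (v @ ?s)}. a (take j (v @ ?s)) \<otimes> f (drop j (v @ ?s)))
      = (\<Oplus>j\<in>{..length v}. a (take j v) \<otimes> f (drop j v @ ?s))"
    by (intro add.finprod_mono_neutral_cong_right) (auto simp: ac fc)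
  then show "strip_suffix ?s (a \<otimes>\<^bsub>free_algebra R X\<^esub> f) v
      = (a \<otimes>\<^bsub>free_algebra R X\<^esub> strip_suffix ?s f) v"
    by (simp only: strip_suffix_def free_algebra_sel)
qed

text \<open>Suffixes of a power of \<open>y\<close> are again powers of \<open>y\<close>, so every
  summand of the convolution at such a word has a zero factor.\<close>

lemma left_ideal_no_powers: "left_ideal (no_powers_ideal R X y) (free_algebra R X)"
proof -
  interpret A: ring "free_algebra R X" by (rule free_algebra_ring)
  have mult: "a \<otimes>\<^bsub>free_algebra R X\<^esub> f \<in> no_powers_ideal R X y"
    if a: "a \<in> free_algebra_carrier R X" and f: "f \<in> no_powers_ideal R X y" for a f
  proof -
    have "a \<otimes>\<^bsub>free_algebra R X\<^esub> f \<in> free_algebra_carrier R X"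
      using a f A.m_closed[of a f] by (simp add: no_powers_ideal_def free_algebra_sel(1))
    then show ?thesis
      using f free_algebra_carrierD(1)[OF a]
      by (simp add: no_powers_ideal_def free_algebra_sel(3) del: take_replicate)
  qed
  have "\<ominus>\<^bsub>free_algebra R X\<^esub> f \<in> no_powers_ideal R X y" if f: "f \<in> no_powers_ideal R X y" for f
  proof -
    have "f \<in> carrier (free_algebra R X)"
      using f by (simp add: no_powers_ideal_def free_algebra_sel(1))
    then have "\<ominus>\<^bsub>free_algebra R X\<^esub> f = \<ominus>\<^bsub>free_algebra R X\<^esub> \<one>\<^bsub>free_algebra R X\<^esub> \<otimes>\<^bsub>free_algebra R X\<^esub> f"
      by (simp add: A.l_minus)
    moreover have "\<ominus>\<^bsub>free_algebra R X\<^esub> \<one>\<^bsub>free_algebra R X\<^esub> \<in> free_algebra_carrier R X"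
      using A.a_inv_closed[OF A.one_closed] by (simp only: free_algebra_sel(1))
    ultimately show ?thesis using mult f by simp
  qed
  moreover have "\<zero>\<^bsub>free_algebra R X\<^esub> \<in> no_powers_ideal R X y"
    using A.zero_closed by (simp add: no_powers_ideal_def free_algebra_sel)
  moreover have "f \<oplus>\<^bsub>free_algebra R X\<^esub> g \<in> no_powers_ideal R X y"
    if "f \<in> no_powers_ideal R X y" "g \<in> no_powers_ideal R X y" for f g
    using that free_algebra_add_closed[of f X g] by (auto simp: no_powers_ideal_def free_algebra_sel)
  moreover have "no_powers_ideal R X y \<subseteq> carrier (free_algebra R X)"
    by (auto simp: no_powers_ideal_def free_algebra_sel)
  ultimately have "subgroup (no_powers_ideal R X y) (add_monoid (free_algebra R X))"
    by (intro A.add.subgroupI) (auto simp: a_inv_def[symmetric])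
  then show ?thesis
    using mult
    by (intro left_ideal.intro left_ideal_axioms.intro additive_subgroup.intro A.ring_axioms)
      (auto simp: free_algebra_sel(1))
qed

text \<open>If the i-th coefficient is nonzero, some word with suffix x y^i occurs in
  \<open>f\<close>, so i is bounded by the length of that word.\<close>

lemma finite_strip_suffix:
  assumes f: "f \<in> free_algebra_carrier R X"
  shows "finite {i. strip_suffix (x # replicate i y) f \<noteq> \<zero>\<^bsub>free_algebra R X\<^esub>}"
proof (rule finite_subset)
  show "finite (\<Union>w\<in>{w. f w \<noteq> \<zero>}. {..length w})"
    using free_algebra_carrierD(2)[OF f] by simp
  show "{i. strip_suffix (x # replicate i y) f \<noteq> \<zero>\<^bsub>free_algebra R X\<^esub>}
      \<subseteq> (\<Union>w\<in>{w. f w \<noteq> \<zero>}. {..length w})"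
    by (force simp: strip_suffix_def free_algebra_sel fun_eq_iff)
qed

lemma word_poly_closed: "w \<in> lists X \<Longrightarrow> word_poly R w \<in> free_algebra_carrier R X"
  by (rule free_algebra_carrierI[of _ "{w}"]) (auto simp: word_poly_def split: if_splits)

lemma word_poly_in_no_powers:
  assumes "x \<in> X" "y \<in> X" "x \<noteq> y"
  shows "word_poly R (x # replicate i y) \<in> no_powers_ideal R X y"
proof -
  have "replicate j y \<noteq> x # replicate i y" for j using assms(3) by (cases j) auto
  moreover have "word_poly R (x # replicate i y) \<in> free_algebra_carrier R X"
    using assms by (intro word_poly_closed) auto
  ultimately show ?thesis by (auto simp: no_powers_ideal_def word_poly_def)
qed

text \<open>The letter \<open>x\<close> occurs only once in x y^i, at the front, so a suffix x y^j
  must be the whole word. Hence x y^i serves as a preimage of the i-th generator.\<close>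

lemma strip_suffix_word_poly:
  assumes "x \<noteq> y"
  shows "strip_suffix (x # replicate j y) (word_poly R (x # replicate i y))
       = (if j = i then \<one>\<^bsub>free_algebra R X\<^esub> else \<zero>\<^bsub>free_algebra R X\<^esub>)"
proof -
  have "v @ x # replicate j y = x # replicate i y \<longleftrightarrow> v = [] \<and> j = i" for v
  proof
    assume eq: "v @ x # replicate j y = x # replicate i y"
    have "v = []"
    proof (cases v)
      case (Cons z zs)
      then have "zs @ x # replicate j y = replicate i y" using eq by simp
      then have "x \<in> set (replicate i y)" by (metis in_set_conv_decomp)
      then show ?thesis using assms by auto
    qed simp
    then show "v = [] \<and> j = i" using eq by (auto dest: arg_cong[where f = length])
  qed auto
  then show ?thesis by (auto simp: strip_suffix_def word_poly_def free_algebra_sel fun_eq_iff)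
qed

end

section \<open>The homomorphism from the ideal \<open>L\<close> onto \<open>M\<close>\<close>

theorem theorem8p1:
  fixes K :: "('k, 'p) ring_scheme"
    and X :: "'x set"
    and M :: "('x list \<Rightarrow> 'k, 'm, 'q) module_scheme"
  assumes "field K"
    and "\<exists>x\<in>X. \<exists>y\<in>X. x \<noteq> y"
    and "left_module (free_algebra K X) M"
    and "countably_generated_module (free_algebra K X) M"
  shows "\<exists>(M' :: ('x list \<Rightarrow> 'k, ('x list \<Rightarrow> 'k) set) module) h.
           left_module (free_algebra K X) M' \<and>
           cyclic_module (free_algebra K X) M' \<and>
           h \<in> left_module_hom (free_algebra K X) M M' \<and>
           inj_on h (carrier M)"
proof -
  interpret K: field K by fact
  define A where "A = free_algebra K X"
  interpret A: left_module A M unfolding A_def by fact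
  obtain x y where xy: "x \<in> X" "y \<in> X" "x \<noteq> y" using assms(2) by blast
  obtain S where S: "countable S" "generates_module A M S"
    using assms(4) by (auto simp: countably_generated_module_def A_def)
  \<comment> \<open>Adding zero makes the set nonempty, so that it has an enumeration by all natural
    numbers; a finite set is listed with repetitions.\<close>
  define m where "m = from_nat_into (insert \<zero>\<^bsub>M\<^esub> S)"
  have range_m: "range m = insert \<zero>\<^bsub>M\<^esub> S" using S(1) by (simp add: m_def range_from_nat_into)
  have "range m \<subseteq> carrier M"
    using S(2) by (simp add: range_m generates_module_def)
  then have mM: "m i \<in> carrier M" for i by auto
  define L where "L = no_powers_ideal K X y"
  interpret L: left_ideal L A unfolding A_def L_def by (rule K.left_ideal_no_powers)
  \<comment> \<open>\<open>c i f\<close> is the left coefficient f_i of x y^i in \<open>f\<close>,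
    and \<open>p\<close> below sends \<open>f\<close> to the sum of the f_i m_i.\<close>
  define c :: "nat \<Rightarrow> ('x list \<Rightarrow> 'k) \<Rightarrow> 'x list \<Rightarrow> 'k"
    where "c i = strip_suffix (x # replicate i y)" for i
  define T where "T f = {i. c i f \<noteq> \<zero>\<^bsub>A\<^esub>}" for f :: "'x list \<Rightarrow> 'k"
  define p where "p f = (\<Oplus>\<^bsub>M\<^esub>i\<in>T f. c i f \<odot>\<^bsub>M\<^esub> m i)" for f
  have cA: "c i f \<in> carrier A" if "f \<in> carrier A" for i f
    using that K.strip_suffix_closed by (simp add: c_def A_def free_algebra_sel(1))
  have T: "finite (T f)" if "f \<in> carrier A" for f
    using K.finite_strip_suffix[of f X x y] that by (simp add: T_def c_def A_def free_algebra_sel(1))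
  \<comment> \<open>Indices outside \<open>T f\<close> contribute zero. Sums belonging to different
    elements can thus be compared over a common finite index set.\<close>
  have p: "p f = (\<Oplus>\<^bsub>M\<^esub>i\<in>B. c i f \<odot>\<^bsub>M\<^esub> m i)" if "f \<in> carrier A" "finite B" "T f \<subseteq> B" for f B
    unfolding p_def
    by (rule A.M.add.finprod_mono_neutral_cong_left) (use that in \<open>auto simp: T_def A.smult_l_null cA mM\<close>)
  have add: "p (f \<oplus>\<^bsub>A\<^esub> g) = p f \<oplus>\<^bsub>M\<^esub> p g" if f: "f \<in> L" and g: "g \<in> L" for f g
  proof -
    have c_add: "c i (f \<oplus>\<^bsub>A\<^esub> g) = c i f \<oplus>\<^bsub>A\<^esub> c i g" for i
      by (simp add: c_def strip_suffix_def A_def free_algebra_sel)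
    then have "T (f \<oplus>\<^bsub>A\<^esub> g) \<subseteq> T f \<union> T g" by (auto simp: T_def)
    then have "p (f \<oplus>\<^bsub>A\<^esub> g) = (\<Oplus>\<^bsub>M\<^esub>i\<in>T f \<union> T g. c i (f \<oplus>\<^bsub>A\<^esub> g) \<odot>\<^bsub>M\<^esub> m i)"
      using f g by (intro p) (auto simp: T)
    also have "\<dots> = (\<Oplus>\<^bsub>M\<^esub>i\<in>T f \<union> T g. c i f \<odot>\<^bsub>M\<^esub> m i \<oplus>\<^bsub>M\<^esub> c i g \<odot>\<^bsub>M\<^esub> m i)"
      using f g by (intro A.M.add.finprod_cong') (auto simp: c_add A.smult_l_distr cA mM)
    also have "\<dots> = (\<Oplus>\<^bsub>M\<^esub>i\<in>T f \<union> T g. c i f \<odot>\<^bsub>M\<^esub> m i) \<oplus>\<^bsub>M\<^esub> (\<Oplus>\<^bsub>M\<^esub>i\<in>T f \<union> T g. c i g \<odot>\<^bsub>M\<^esub> m i)"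
      using f g by (intro A.M.finsum_addf) (auto simp: cA mM)
    also have "\<dots> = p f \<oplus>\<^bsub>M\<^esub> p g"
      using f g by (simp add: p[symmetric] T)
    finally show ?thesis .
  qed
  have smult: "p (a \<otimes>\<^bsub>A\<^esub> f) = a \<odot>\<^bsub>M\<^esub> p f" if a: "a \<in> carrier A" and f: "f \<in> L" for a f
  proof -
    \<comment> \<open>This is what confines \<open>p\<close> to \<open>L\<close>: for other
      \<open>f\<close>, cuts inside the suffix x y^i may contribute to the product.\<close>
    have c_mult: "c i (a \<otimes>\<^bsub>A\<^esub> f) = a \<otimes>\<^bsub>A\<^esub> c i f" for i
      using K.strip_suffix_mult[of a X f y x i] a f by (simp add: c_def A_def L_def free_algebra_sel(1))
    then have "T (a \<otimes>\<^bsub>A\<^esub> f) \<subseteq> T f" using a by (auto simp: T_def)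
    then have "p (a \<otimes>\<^bsub>A\<^esub> f) = (\<Oplus>\<^bsub>M\<^esub>i\<in>T f. c i (a \<otimes>\<^bsub>A\<^esub> f) \<odot>\<^bsub>M\<^esub> m i)"
      using a f by (intro p) (auto simp: T)
    also have "\<dots> = (\<Oplus>\<^bsub>M\<^esub>i\<in>T f. a \<odot>\<^bsub>M\<^esub> (c i f \<odot>\<^bsub>M\<^esub> m i))"
      using a f by (intro A.M.add.finprod_cong') (auto simp: c_mult A.smult_assoc cA mM)
    also have "\<dots> = a \<odot>\<^bsub>M\<^esub> p f"
      unfolding p_def using a f by (intro A.finsum_smult_distr[symmetric]) (auto simp: T cA mM)
    finally show ?thesis .
  qed
  \<comment> \<open>The image is a submodule, so it is enough that it contains the generators;
    \<open>p\<close> maps x y^i to \<open>m i\<close>.\<close>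
  have "p ` L = carrier M"
  proof (rule A.submodule_eq_carrier[OF S(2)])
    show "submodule (p ` L) A M"
    proof (rule A.submoduleI)
      show "p ` L \<subseteq> carrier M"
        by (auto simp: p_def cA mM intro!: A.M.finsum_closed)
      have "p \<zero>\<^bsub>A\<^esub> = \<zero>\<^bsub>M\<^esub>"
        by (simp add: p_def T_def c_def strip_suffix_def A_def free_algebra_sel)
      then show "\<zero>\<^bsub>M\<^esub> \<in> p ` L" using L.zero_closed by (metis imageI)
      show "u \<oplus>\<^bsub>M\<^esub> v \<in> p ` L" if "u \<in> p ` L" "v \<in> p ` L" for u v
        using that L.a_closed by (metis (no_types, lifting) add imageE imageI)
      show "a \<odot>\<^bsub>M\<^esub> u \<in> p ` L" if "a \<in> carrier A" "u \<in> p ` L" for a u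
        using that L.l_closed by (metis (no_types, lifting) smult imageE imageI)
    qed
    have "m i \<in> p ` L" for i
    proof
      let ?w = "word_poly K (x # replicate i y)"
      show w: "?w \<in> L" unfolding L_def using xy by (rule K.word_poly_in_no_powers)
      have c: "c j ?w = (if j = i then \<one>\<^bsub>A\<^esub> else \<zero>\<^bsub>A\<^esub>)" for j
        unfolding c_def A_def using xy(3) by (rule K.strip_suffix_word_poly)
      have "p ?w = (\<Oplus>\<^bsub>M\<^esub>j\<in>{i}. c j ?w \<odot>\<^bsub>M\<^esub> m j)"
        using w by (intro p) (auto simp: T_def c split: if_splits)
      then show "m i = p ?w" by (simp add: c mM)
    qed
    then show "S \<subseteq> p ` L" using range_m by (metis image_subset_iff insert_subset)
  qed
  then show ?thesis
    using A.subquotient_embeds_into_cyclic[OF L.left_ideal_axioms add smult] by (simp only: A_def)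
qed

end
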